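(* Fix $n\ge 6$. Any two strong bicentral $2$-trees on $n$ vertices with tail set $\{2,3\}$ having exactly two tail vertices of degree $3$ are isomorphic; that is, such a graph is unique up to isomorphism.
   Context: A $2$-tree is a graph obtained from the triangle $K_3$ by repeatedly adding a new vertex adjacent to both endpoints of an existing edge. For $r\in\{1,2,3\}$ and an integer $\Delta\ge 2$, a $2$-tree on $n$ vertices is $r$-central with maximum degree $\Delta$ if $\Delta$ is its maximum degree and exactly $r$ vertices have degree $\Delta$; these $r$ vertices form the core and the other $n-r$ vertices form the tail. It is strong if the core induces $K_r$. It has tail set $\{2,3\}$ if every tail vertex has degree $2$ or $3$. "Bicentral" means $2$-central. *)

theory Defs
  imports Main
begin

text \<open>
  A finite simple graph is given by its vertex set \<open>V\<close> and its edge set \<open>E\<close>,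
  an edge being a two-element subset of \<open>V\<close>.
\<close>

text \<open>In \<open>extend\<close>, \<open>u \<noteq> v\<close> is automatic, since \<open>E\<close> only ever contains two-element sets.\<close>

inductive two_tree :: "'a set \<Rightarrow> 'a set set \<Rightarrow> bool" where
  triangle: "distinct [a, b, c] \<Longrightarrow> two_tree {a, b, c} {{a, b}, {a, c}, {b, c}}"
| extend: "two_tree V E \<Longrightarrow> {u, v} \<in> E \<Longrightarrow> w \<notin> V \<Longrightarrow>
    two_tree (insert w V) (E \<union> {{w, u}, {w, v}})"

definition degree :: "'a set set \<Rightarrow> 'a \<Rightarrow> nat" where
  "degree E v = card {e \<in> E. v \<in> e}"

definition max_degree :: "'a set \<Rightarrow> 'a set set \<Rightarrow> nat" where
  "max_degree V E = Max (degree E ` V)"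

definition core :: "'a set \<Rightarrow> 'a set set \<Rightarrow> 'a set" where
  "core V E = {v \<in> V. degree E v = max_degree V E}"

definition tail :: "'a set \<Rightarrow> 'a set set \<Rightarrow> 'a set" where
  "tail V E = V - core V E"

definition central_two_tree :: "nat \<Rightarrow> nat \<Rightarrow> 'a set \<Rightarrow> 'a set set \<Rightarrow> bool" where
  "central_two_tree r \<Delta> V E \<longleftrightarrow>
     r \<in> {1, 2, 3} \<and> \<Delta> \<ge> 2 \<and> two_tree V E \<and> max_degree V E = \<Delta> \<and> card (core V E) = r"

definition induced_edges :: "'a set set \<Rightarrow> 'a set \<Rightarrow> 'a set set" where
  "induced_edges E S = {e \<in> E. e \<subseteq> S}"

definition complete_edges :: "'a set \<Rightarrow> 'a set set" where
  "complete_edges S = {e. e \<subseteq> S \<and> card e = 2}"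

definition strong_central_two_tree :: "nat \<Rightarrow> nat \<Rightarrow> 'a set \<Rightarrow> 'a set set \<Rightarrow> bool" where
  "strong_central_two_tree r \<Delta> V E \<longleftrightarrow>
     central_two_tree r \<Delta> V E \<and> induced_edges E (core V E) = complete_edges (core V E)"

text \<open>Not every degree in \<open>D\<close> has to be attained by a tail vertex.\<close>

definition has_tail_set :: "'a set \<Rightarrow> 'a set set \<Rightarrow> nat set \<Rightarrow> bool" where
  "has_tail_set V E D \<longleftrightarrow> (\<forall>v \<in> tail V E. degree E v \<in> D)"

definition graph_isomorphic :: "'a set \<Rightarrow> 'a set set \<Rightarrow> 'b set \<Rightarrow> 'b set set \<Rightarrow> bool" where
  "graph_isomorphic V E V' E' \<longleftrightarrow>
     (\<exists>f. bij_betw f V V' \<and> (\<forall>u \<in> V. \<forall>v \<in> V. {u, v} \<in> E \<longleftrightarrow> {f u, f v} \<in> E'))"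

end

theory Submission imports Defs begin

text \<open>
  Counting edges gives \<open>\<Delta> = n - 2\<close>, so each core vertex \<open>x\<close>, \<open>y\<close> misses exactly one other
  vertex, say \<open>p\<close> and \<open>q\<close>. A tail vertex other than \<open>p\<close> and \<open>q\<close> sees both core vertices and so has
  degree 3 as soon as it has one neighbour in the tail. As the neighbours of a vertex of degree 2 are
  adjacent, \<open>p = q\<close> and \<open>p \<sim> q\<close> are impossible. Hence \<open>p\<close> and \<open>q\<close> have neighbours \<open>a\<close> and \<open>b\<close> in the
  tail, which are the two vertices of degree 3, and this determines every edge.
\<close>

section \<open>Neighbourhoods, degrees and edge counts\<close>

definition neighbours :: "'a set set \<Rightarrow> 'a \<Rightarrow> 'a set" where
  "neighbours E v = {u. {v, u} \<in> E}"

lemma neighbours_sym: "u \<in> neighbours E v \<longleftrightarrow> v \<in> neighbours E u"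
  by (simp add: neighbours_def insert_commute)

lemma two_tree_wf:
  assumes "two_tree V E"
  shows "finite V" "\<And>e. e \<in> E \<Longrightarrow> e \<subseteq> V \<and> card e = 2"
proof -
  from assms have "finite V \<and> (\<forall>e \<in> E. e \<subseteq> V \<and> card e = 2)"
  proof induction
    case (triangle a b c)
    then show ?case by auto
  next
    case (extend V E u v w)
    then have "u \<in> V" "v \<in> V" "w \<noteq> u" "w \<noteq> v" by auto
    with extend show ?case by auto
  qed
  then show "finite V" "\<And>e. e \<in> E \<Longrightarrow> e \<subseteq> V \<and> card e = 2" by auto
qed

lemma two_tree_finite_edges: "two_tree V E \<Longrightarrow> finite E"
  by (rule finite_subset[of _ "Pow V"]) (use two_tree_wf in blast)+

lemma two_tree_neighbours:
  assumes "two_tree V E"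
  shows "neighbours E v \<subseteq> V - {v}" "finite (neighbours E v)"
proof -
  show "neighbours E v \<subseteq> V - {v}"
    using two_tree_wf(2)[OF assms] by (fastforce simp: neighbours_def)
  then show "finite (neighbours E v)"
    using two_tree_wf(1)[OF assms] finite_subset by blast
qed

lemma degree_eq_card_neighbours:
  assumes "\<And>e. e \<in> E \<Longrightarrow> card e = 2"
  shows "degree E v = card (neighbours E v)"
proof -
  have "bij_betw (\<lambda>u. {v, u}) (neighbours E v) {e \<in> E. v \<in> e}"
    unfolding bij_betw_def
  proof
    show "inj_on (\<lambda>u. {v, u}) (neighbours E v)"
      by (auto simp: inj_on_def doubleton_eq_iff)
    show "(\<lambda>u. {v, u}) ` neighbours E v = {e \<in> E. v \<in> e}"
    proof (intro equalityI subsetI)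
      fix e assume "e \<in> {e \<in> E. v \<in> e}"
      then have e: "e \<in> E" "v \<in> e" "card e = 2" using assms by auto
      then obtain u where "e = {v, u}" by (auto simp: card_2_iff)
      then show "e \<in> (\<lambda>u. {v, u}) ` neighbours E v"
        using e by (auto simp: neighbours_def)
    qed (auto simp: neighbours_def)
  qed
  then show ?thesis
    unfolding degree_def by (simp add: bij_betw_same_card)
qed

lemma two_tree_degree:
  "two_tree V E \<Longrightarrow> degree E v = card (neighbours E v)"
  by (rule degree_eq_card_neighbours) (use two_tree_wf in blast)

text \<open>The triangle has three vertices and three edges, and each extension adds one vertex and
  two edges. The additive form avoids truncated subtraction.\<close>

lemma two_tree_card_edges:
  "two_tree V E \<Longrightarrow> card E + 3 = 2 * card V"
proof (induction rule: two_tree.induct)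
  case (triangle a b c)
  then show ?case by (simp add: doubleton_eq_iff)
next
  case (extend V E u v w)
  have "u \<noteq> v" using two_tree_wf(2)[OF extend.hyps(1,2)] by auto
  moreover have "{w, u} \<notin> E" "{w, v} \<notin> E"
    using two_tree_wf(2)[OF extend.hyps(1)] extend.hyps(3) by blast+
  moreover have "E \<union> {{w, u}, {w, v}} = insert {w, u} (insert {w, v} E)" by auto
  ultimately show ?case
    using extend two_tree_wf(1)[OF extend.hyps(1)] two_tree_finite_edges[OF extend.hyps(1)]
    by (auto simp: doubleton_eq_iff)
qed

text \<open>Double counting of incidences: every edge contains exactly two vertices.\<close>

lemma sum_degree:
  assumes "finite V" "finite E" "\<And>e. e \<in> E \<Longrightarrow> e \<subseteq> V \<and> card e = 2"
  shows "(\<Sum>v\<in>V. degree E v) = 2 * card E"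
proof -
  have "(\<Sum>v\<in>V. card {e \<in> E. v \<in> e}) = 2 * card E"
  proof (rule sum_multicount[OF assms(1,2)], rule ballI)
    fix e assume "e \<in> E"
    then have "{v \<in> V. v \<in> e} = e" "card e = 2" using assms(3) by blast+
    then show "card {v \<in> V. v \<in> e} = 2" by simp
  qed
  then show ?thesis by (simp add: degree_def)
qed

section \<open>Vertices of degree 2 under extension\<close>

lemma two_tree_neighbours_extend:
  assumes "two_tree V E" "{u, v} \<in> E" "w \<notin> V"
  defines "E' \<equiv> E \<union> {{w, u}, {w, v}}"
  shows "neighbours E' w = {u, v}"
    and "z = u \<or> z = v \<Longrightarrow> neighbours E' z = insert w (neighbours E z)"
    and "z \<notin> {u, v, w} \<Longrightarrow> neighbours E' z = neighbours E z"
proof -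
  have uv: "u \<in> V" "v \<in> V" using two_tree_wf(2)[OF assms(1,2)] by auto
  have w: "{w, z} \<notin> E" for z using two_tree_wf(2)[OF assms(1)] assms(3) by blast
  show "neighbours E' w = {u, v}"
    using uv w by (auto simp: neighbours_def E'_def doubleton_eq_iff)
  show "neighbours E' z = insert w (neighbours E z)" if "z = u \<or> z = v"
    using uv assms(3) that by (auto simp: neighbours_def E'_def doubleton_eq_iff)
  show "neighbours E' z = neighbours E z" if "z \<notin> {u, v, w}"
    using that by (auto simp: neighbours_def E'_def doubleton_eq_iff)
qed

text \<open>A new vertex starts with two neighbours, and extensions never remove any.\<close>

lemma two_tree_min_degree:
  "two_tree V E \<Longrightarrow> z \<in> V \<Longrightarrow> card (neighbours E z) \<ge> 2"
proof (induction rule: two_tree.induct)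
  case (triangle a b c)
  have "neighbours {{a, b}, {a, c}, {b, c}} z = {a, b, c} - {z}"
    using triangle by (auto simp: neighbours_def doubleton_eq_iff)
  moreover have "card ({a, b, c} - {z}) = 2" using triangle by auto
  ultimately show ?case by simp
next
  case (extend V E u v w)
  note nb = two_tree_neighbours_extend[OF extend.hyps]
  have uv: "u \<in> V" "v \<in> V" "u \<noteq> v" using two_tree_wf(2)[OF extend.hyps(1,2)] by auto
  consider "z = w" | "z = u \<or> z = v" | "z \<notin> {u, v, w}" by blast
  then show ?case
  proof cases
    case 1
    then show ?thesis using nb(1) uv by simp
  next
    case 2
    then have "card (neighbours E z) \<ge> 2" using extend.IH uv by auto
    also have "\<dots> \<le> card (insert w (neighbours E z))"
      by (rule card_mono) (use two_tree_neighbours(2)[OF extend.hyps(1)] in auto)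
    finally show ?thesis using nb(2)[OF 2] by simp
  next
    case 3
    then show ?thesis using nb(3)[OF 3] extend by auto
  qed
qed

text \<open>The last extension leaves three cases. The new vertex sees the two ends of an old edge,
  an endpoint of that edge now has degree at least 3, and any other vertex keeps its neighbourhood,
  so that induction applies.\<close>

lemma two_tree_degree_2_neighbours_adjacent:
  "two_tree V E \<Longrightarrow> neighbours E z = {s, t} \<Longrightarrow> s \<noteq> t \<Longrightarrow> t \<in> neighbours E s"
proof (induction arbitrary: z s t rule: two_tree.induct)
  case (triangle a b c)
  have "s \<in> neighbours {{a, b}, {a, c}, {b, c}} z" "t \<in> neighbours {{a, b}, {a, c}, {b, c}} z"
    using triangle by auto
  then show ?case
    using triangle.hyps triangle.prems(2) by (auto simp: neighbours_def doubleton_eq_iff)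
next
  case (extend V E u v w)
  note nb = two_tree_neighbours_extend[OF extend.hyps]
  have uv: "u \<in> V" "v \<in> V" using two_tree_wf(2)[OF extend.hyps(1,2)] by auto
  consider "z = w" | "z = u \<or> z = v" | "z \<notin> {u, v, w}" by blast
  then show ?case
  proof cases
    case 1
    then have "{s, t} = {u, v}" using nb(1) extend.prems by simp
    then show ?thesis using extend.hyps(2) by (auto simp: neighbours_def doubleton_eq_iff insert_commute)
  next
    case 2
    \<comment> \<open>The neighbourhood of \<open>z\<close> grows from at least two elements to at
      least three, so it cannot be \<open>{s, t}\<close>.\<close>
    have "w \<notin> neighbours E z" using two_tree_neighbours(1)[OF extend.hyps(1)] extend.hyps(3) by auto
    then have "card (insert w (neighbours E z)) = Suc (card (neighbours E z))"
      using two_tree_neighbours(2)[OF extend.hyps(1)] by simp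
    moreover have "card (neighbours E z) \<ge> 2" using two_tree_min_degree[OF extend.hyps(1)] 2 uv by auto
    moreover have "card {s, t} = 2" using extend.prems by simp
    ultimately show ?thesis using nb(2)[OF 2] extend.prems by simp
  next
    case 3
    then have "t \<in> neighbours E s" using nb(3)[OF 3] extend by auto
    then show ?thesis by (auto simp: neighbours_def)
  qed
qed

section \<open>Isomorphisms and the canonical form\<close>

lemma graph_isomorphic_image:
  assumes bij: "bij_betw f V V'" and "\<And>e. e \<in> E \<Longrightarrow> e \<subseteq> V" and E': "E' = (`) f ` E"
  shows "graph_isomorphic V E V' E'"
  unfolding graph_isomorphic_def
proof (intro exI[of _ f] conjI ballI bij)
  fix u v assume uv: "u \<in> V" "v \<in> V"
  have inj: "inj_on f V" using bij by (simp add: bij_betw_def)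
  have "{u, v} \<in> E" if "e \<in> E" "f ` e = f ` {u, v}" for e
    using inj_on_image_eq_iff[OF inj, of e "{u, v}"] assms(2)[OF that(1)] that uv by simp
  then have "{u, v} \<in> E \<longleftrightarrow> f ` {u, v} \<in> E'" unfolding E' by (metis imageE imageI)
  then show "{u, v} \<in> E \<longleftrightarrow> {f u, f v} \<in> E'" by simp
qed

text \<open>The book with spine \<open>xy\<close>, where \<open>p\<close> is attached to \<open>ya\<close> and \<open>q\<close> to \<open>xb\<close> instead.\<close>

definition book_with_ears :: "'a set \<Rightarrow> 'a \<Rightarrow> 'a \<Rightarrow> 'a \<Rightarrow> 'a \<Rightarrow> 'a \<Rightarrow> 'a \<Rightarrow> 'a set set" where
  "book_with_ears V x y p q a b =
     insert {p, a} (insert {q, b}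
       ((\<lambda>v. {x, v}) ` (V - {x, p}) \<union> (\<lambda>v. {y, v}) ` (V - {y, q})))"

text \<open>The edge set is built by images, unions and set differences; injectivity is what lets
  \<open>f\<close> commute with the differences.\<close>

lemma book_with_ears_image:
  assumes "inj_on f V" "{x, y, p, q} \<subseteq> V"
  shows "(`) f ` book_with_ears V x y p q a b =
    book_with_ears (f ` V) (f x) (f y) (f p) (f q) (f a) (f b)"
proof -
  have "f ` V - {f x, f p} = f ` (V - {x, p})" "f ` V - {f y, f q} = f ` (V - {y, q})"
    using assms by (auto simp: inj_on_def)
  then show ?thesis
    unfolding book_with_ears_def by (simp add: image_Un image_image)
qed

text \<open>The complements of the two lists have equal size, so any bijection between them can be
  glued to the map prescribed on the lists.\<close>

lemma ex_bij_betw_extending_list: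
  assumes "finite V" "finite V'" "card V = card V'"
    and "distinct xs" "distinct ys" "length xs = length ys" "set xs \<subseteq> V" "set ys \<subseteq> V'"
  shows "\<exists>f. bij_betw f V V' \<and> map f xs = ys"
proof -
  have "card (V - set xs) = card (V' - set ys)"
    using assms by (simp add: card_Diff_subset distinct_card)
  then obtain g where g: "bij_betw g (V - set xs) (V' - set ys)"
    using assms finite_same_card_bij by (metis finite_Diff)
  define h where "h v = the (map_of (zip xs ys) v)" for v
  have h: "h (xs ! i) = ys ! i" if "i < length xs" for i
    using that assms by (simp add: h_def map_of_zip_nth)
  then have map: "map h xs = ys" using assms by (simp add: list_eq_iff_nth_eq)
  then have "bij_betw h (set xs) (set ys)"
    unfolding bij_betw_def using assms by (metis distinct_map list.set_map)
  with g have "bij_betw (\<lambda>v. if v \<in> set xs then h v else g v)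
      (set xs \<union> (V - set xs)) (set ys \<union> (V' - set ys))"
    by (intro bij_betw_disjoint_Un) auto
  moreover have "set xs \<union> (V - set xs) = V" "set ys \<union> (V' - set ys) = V'" using assms by auto
  moreover have "map (\<lambda>v. if v \<in> set xs then h v else g v) xs = ys" using map by auto
  ultimately show ?thesis by metis
qed

section \<open>Structure of the bicentral graph\<close>

text \<open>A canonical form: \<open>V\<close> and six distinguished vertices determine all edges,
  which reduces uniqueness to relabelling.\<close>

lemma strong_bicentral_is_book_with_ears:
  assumes n: "card V \<ge> 6"
    and strong: "strong_central_two_tree 2 \<Delta> V E"
    and tail_set: "has_tail_set V E {2, 3}"
    and card3: "card {v \<in> tail V E. degree E v = 3} = 2"
  shows "\<exists>x y p q a b. distinct [x, y, p, q, a, b] \<and> {x, y, p, q, a, b} \<subseteq> V \<and>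
    E = book_with_ears V x y p q a b"
proof -
  from strong have tt: "two_tree V E" and max: "max_degree V E = \<Delta>" and core2: "card (core V E) = 2"
    and ind: "induced_edges E (core V E) = complete_edges (core V E)"
    by (auto simp: strong_central_two_tree_def central_two_tree_def)
  let ?N = "neighbours E"
  note fin = two_tree_wf(1)[OF tt] and deg = two_tree_degree[OF tt]
    and N_sub = two_tree_neighbours(1)[OF tt] and N_fin = two_tree_neighbours(2)[OF tt]
  obtain x y where core: "core V E = {x, y}" and "x \<noteq> y" using core2 by (auto simp: card_2_iff)
  then have xyV: "x \<in> V" "y \<in> V" and degxy: "card (?N x) = \<Delta>" "card (?N y) = \<Delta>"
    using max deg by (auto simp: core_def)
  \<comment> \<open>Strongness enters as the edge \<open>{x, y}\<close>; it later forces
    \<open>p\<close> and \<open>q\<close> to be tail vertices.\<close>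
  have "{x, y} \<in> induced_edges E (core V E)"
    unfolding ind using core \<open>x \<noteq> y\<close> by (simp add: complete_edges_def)
  then have xy: "y \<in> ?N x" by (simp add: induced_edges_def neighbours_def)
  have tail: "tail V E = V - {x, y}" by (simp add: tail_def core)
  define T where "T = {v \<in> tail V E. degree E v = 3}"
  have T: "T \<subseteq> V - {x, y}" "card T = 2" using card3 by (auto simp: T_def tail)
  have finT: "finite T" using T fin finite_subset by blast
  have deg3: "card (?N v) = 3" if "v \<in> T" for v using that deg by (auto simp: T_def)
  have deg2: "card (?N v) = 2" if "v \<in> V - {x, y} - T" for v
    using that tail_set deg by (auto simp: T_def has_tail_set_def tail)

  have "card (V - {x, y} - T) = card V - 4"
    using T fin finT xyV \<open>x \<noteq> y\<close> by (simp add: card_Diff_subset)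
  then have "(\<Sum>v\<in>V - {x, y} - T. card (?N v)) = 2 * (card V - 4)"
    using deg2 by simp
  moreover have "(\<Sum>v\<in>T. card (?N v)) = 6" using deg3 T by simp
  moreover have "(\<Sum>v\<in>V - {x, y}. card (?N v)) =
      (\<Sum>v\<in>V - {x, y} - T. card (?N v)) + (\<Sum>v\<in>T. card (?N v))"
    using T fin by (intro sum.subset_diff) auto
  moreover have "(\<Sum>v\<in>V. card (?N v)) = (\<Sum>v\<in>V - {x, y}. card (?N v)) + (\<Sum>v\<in>{x, y}. card (?N v))"
    using xyV fin by (intro sum.subset_diff) auto
  moreover have "(\<Sum>v\<in>{x, y}. card (?N v)) = 2 * \<Delta>" using degxy \<open>x \<noteq> y\<close> by simp
  moreover have "(\<Sum>v\<in>V. card (?N v)) = 2 * card E"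
    using sum_degree[OF fin two_tree_finite_edges[OF tt] two_tree_wf(2)[OF tt]] deg by simp
  \<comment> \<open>With \<open>n = card V\<close>, the degree sum reads
    \<open>2 * (n - 4) + 6 + 2 * \<Delta> = 2 * (2 * n - 3)\<close>.\<close>
  ultimately have \<Delta>: "\<Delta> + 2 = card V" using two_tree_card_edges[OF tt] n by linarith

  have missing: "\<exists>p. p \<in> V \<and> p \<noteq> c \<and> ?N c = V - {c, p}" if "c \<in> V" "card (?N c) = \<Delta>" for c
  proof -
    have "card (V - {c} - ?N c) = 1"
      using N_sub[of c] N_fin[of c] that \<Delta> fin by (simp add: card_Diff_subset)
    then obtain p where p: "V - {c} - ?N c = {p}" by (auto simp: card_1_singleton_iff)
    then show ?thesis using N_sub[of c] by blast
  qed
  obtain p where p: "p \<in> V" "p \<noteq> x" "?N x = V - {x, p}" using missing[OF xyV(1) degxy(1)] by blast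
  obtain q where q: "q \<in> V" "q \<noteq> y" "?N y = V - {y, q}" using missing[OF xyV(2) degxy(2)] by blast
  have "p \<noteq> y" using p xy by auto
  have "q \<noteq> x" using q xy neighbours_sym[of y E x] by auto
  have sees_x: "x \<in> ?N v \<longleftrightarrow> v \<in> V \<and> v \<noteq> x \<and> v \<noteq> p" for v
    using p(3) neighbours_sym[of x E v] by blast
  have sees_y: "y \<in> ?N v \<longleftrightarrow> v \<in> V \<and> v \<noteq> y \<and> v \<noteq> q" for v
    using q(3) neighbours_sym[of y E v] by blast
  have le3: "card (?N v) \<le> 3" if "v \<in> V - {x, y}" for v using that deg2 deg3 by fastforce
  \<comment> \<open>Tail degrees are at most 3, so three known neighbours are all of them.\<close>
  have in_T: "v \<in> T \<and> ?N v = {r, s, t}"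
    if "v \<in> V - {x, y}" "r \<in> ?N v" "s \<in> ?N v" "t \<in> ?N v" "distinct [r, s, t]" for v r s t
  proof -
    have "{r, s, t} \<subseteq> ?N v" "card {r, s, t} = 3" using that by auto
    then have "?N v = {r, s, t}" using card_seteq[OF N_fin[of v]] le3[OF that(1)] by metis
    then show ?thesis using deg2 that(1) \<open>card {r, s, t} = 3\<close> by fastforce
  qed
  \<comment> \<open>Two known neighbours of a vertex of degree 2 are all of them, and they must be
    adjacent.\<close>
  have N2: "?N v = {r, s} \<and> s \<in> ?N r"
    if "v \<in> V - {x, y} - T" "r \<in> ?N v" "s \<in> ?N v" "r \<noteq> s" for v r s
  proof -
    have "?N v = {r, s}"
      using card_seteq[OF N_fin[of v], of "{r, s}"] deg2[OF that(1)] that by simp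
    then show ?thesis using two_tree_degree_2_neighbours_adjacent[OF tt] that(4) by blast
  qed
  have T_eq: "T = {a, b}" if "a \<in> T" "b \<in> T" "a \<noteq> b" for a b
    using card_seteq[OF finT, of "{a, b}"] T that by simp
  have ex_other: "\<exists>a \<in> ?N v. a \<noteq> r" if "v \<in> V" for v r
  proof (rule ccontr)
    assume "\<not> ?thesis"
    then have "?N v \<subseteq> {r}" by blast
    then have "card (?N v) \<le> 1" using card_mono[of "{r}"] by fastforce
    then show False using two_tree_min_degree[OF tt that] by simp
  qed

  \<comment> \<open>Otherwise \<open>p\<close> sees neither core vertex and has two tail neighbours
    \<open>a\<close> and \<open>b\<close>. Both see \<open>x\<close>, \<open>y\<close> and
    \<open>p\<close>, so they fill \<open>T\<close>. Then \<open>p\<close> has degree 2 and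
    \<open>a\<close>, \<open>b\<close> are adjacent, giving \<open>a\<close> a fourth
    neighbour.\<close>
  have "p \<noteq> q"
  proof
    assume "p = q"
    obtain a where a: "a \<in> ?N p" using ex_other p by blast
    obtain b where b: "b \<in> ?N p" "b \<noteq> a" using ex_other p by blast
    have aV: "a \<in> V - {x, y, p}" and bV: "b \<in> V - {x, y, p}"
      using a b N_sub[of p] sees_x[of p] sees_y[of p] \<open>p = q\<close> by auto
    have Na: "a \<in> T \<and> ?N a = {x, y, p}" and "b \<in> T"
      using in_T[of a x y p] in_T[of b x y p] aV bV a b sees_x sees_y \<open>p = q\<close> \<open>x \<noteq> y\<close>
        \<open>p \<noteq> y\<close> p neighbours_sym[of p E] by auto
    then have "p \<notin> T" using T_eq[of a b] aV bV b by auto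
    then have "b \<in> ?N a" using N2[of p a b] a b p \<open>p \<noteq> y\<close> by auto
    then show False using Na bV by auto
  qed
  have yp: "y \<in> ?N p" using sees_y p \<open>p \<noteq> y\<close> \<open>p \<noteq> q\<close> by auto
  have xq: "x \<in> ?N q" using sees_x q \<open>q \<noteq> x\<close> \<open>p \<noteq> q\<close> by auto
  \<comment> \<open>If \<open>p\<close> had degree 2, its neighbours \<open>q\<close> and
    \<open>y\<close> would be adjacent, but \<open>y\<close> misses \<open>q\<close>. So
    \<open>p\<close>, and likewise \<open>q\<close>, lies in \<open>T\<close>. A third neighbour
    \<open>c\<close> of \<open>p\<close> sees \<open>x\<close>, \<open>y\<close> and
    \<open>p\<close>, hence is one vertex too many in \<open>T\<close>.\<close>
  have not_pq: "q \<notin> ?N p"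
  proof
    assume pq: "q \<in> ?N p"
    then have qp: "p \<in> ?N q" using neighbours_sym by metis
    have pT: "p \<in> T" using N2[of p q y] pq yp sees_y[of q] p q \<open>p \<noteq> y\<close> by auto
    have qT: "q \<in> T" using N2[of q p x] qp xq sees_x[of p] p q \<open>q \<noteq> x\<close> by auto
    have Teq: "T = {p, q}" using T_eq pT qT \<open>p \<noteq> q\<close> by auto
    have "\<not> ?N p \<subseteq> {y, q}" using card_mono[of "{y, q}" "?N p"] deg3[OF pT] q by auto
    then obtain c where c: "c \<in> ?N p" "c \<noteq> y" "c \<noteq> q" by auto
    then have cV: "c \<in> V - {x, y, p, q}" using N_sub[of p] sees_x[of p] by auto
    then have "c \<in> T"
      using in_T[of c x y p] c sees_x sees_y \<open>x \<noteq> y\<close> \<open>p \<noteq> y\<close> p neighbours_sym[of p E] by auto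
    then show False using Teq cV by auto
  qed
  then have not_qp: "p \<notin> ?N q" using neighbours_sym by metis
  obtain a where a: "a \<in> ?N p" "a \<noteq> y" using ex_other p by blast
  obtain b where b: "b \<in> ?N q" "b \<noteq> x" using ex_other q by blast
  have aV: "a \<in> V - {x, y, p, q}" using a N_sub[of p] sees_x[of p] not_pq by auto
  have bV: "b \<in> V - {x, y, p, q}" using b N_sub[of q] sees_y[of q] not_qp by auto
  have Na: "a \<in> T \<and> ?N a = {x, y, p}"
    using in_T[of a x y p] aV a sees_x sees_y \<open>x \<noteq> y\<close> \<open>p \<noteq> y\<close> p neighbours_sym[of p E] by auto
  have Nb: "b \<in> T \<and> ?N b = {x, y, q}"
    using in_T[of b x y q] bV b sees_x sees_y \<open>x \<noteq> y\<close> \<open>q \<noteq> x\<close> q neighbours_sym[of q E] by auto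
  have "a \<noteq> b" using Na Nb \<open>p \<noteq> q\<close> p q \<open>p \<noteq> y\<close> by auto
  then have Teq: "T = {a, b}" using T_eq Na Nb by auto
  have Np: "?N p = {y, a}" using N2[of p y a] Teq aV bV p \<open>p \<noteq> y\<close> yp a by auto
  have Nq: "?N q = {x, b}" using N2[of q x b] Teq aV bV q \<open>q \<noteq> x\<close> xq b by auto
  have Nv: "?N v = {x, y}" if "v \<in> V - {x, y, p, q, a, b}" for v
    using N2[of v x y] that Teq sees_x[of v] sees_y[of v] \<open>x \<noteq> y\<close> by auto

  have "E = book_with_ears V x y p q a b"
  proof (intro equalityI subsetI)
    fix e assume e: "e \<in> E"
    then have "e \<subseteq> V" "card e = 2" using two_tree_wf(2)[OF tt] by auto
    then obtain u v where uv: "e = {u, v}" "u \<in> V" "v \<in> V" by (auto simp: card_2_iff)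
    then have v: "v \<in> ?N u" using e by (simp add: neighbours_def)
    have u: "u \<in> ?N v" using v neighbours_sym by metis
    have star_x: "{x, w} \<in> book_with_ears V x y p q a b" if "w \<in> ?N x" for w
      using that p(3) by (auto simp: book_with_ears_def)
    have star_y: "{y, w} \<in> book_with_ears V x y p q a b" if "w \<in> ?N y" for w
      using that q(3) by (auto simp: book_with_ears_def)
    have ears: "{p, a} \<in> book_with_ears V x y p q a b" "{q, b} \<in> book_with_ears V x y p q a b"
      by (auto simp: book_with_ears_def)
    show "e \<in> book_with_ears V x y p q a b"
    \<comment> \<open>An edge meeting the spine belongs to the star of \<open>x\<close> or of
      \<open>y\<close>. For an edge avoiding it, \<open>u\<close> has a tail neighbour, which leaves
      only \<open>p\<close>, \<open>q\<close>, \<open>a\<close> and \<open>b\<close>, and the edge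
      is an ear.\<close>
    proof (cases "u \<in> {x, y} \<or> v \<in> {x, y}")
      case True
      then show ?thesis
        using star_x[of u] star_x[of v] star_y[of u] star_y[of v] u v uv(1)
        by (elim disjE insertE emptyE) (simp_all add: insert_commute)
    next
      case False
      have "u \<in> {p, q, a, b}"
      proof (rule ccontr)
        assume "u \<notin> {p, q, a, b}"
        then have "?N u = {x, y}" using Nv[of u] uv(2) False by simp
        then show False using v False by simp
      qed
      then show ?thesis
        using v Np Nq Na Nb False ears unfolding uv(1)
        by (elim insertE emptyE) (simp_all add: insert_commute)
    qed
  next
    fix e assume "e \<in> book_with_ears V x y p q a b"
    then show "e \<in> E"
      using a b p(3) q(3) by (auto simp: book_with_ears_def neighbours_def)
  qed
  moreover have "distinct [x, y, p, q, a, b]" "{x, y, p, q, a, b} \<subseteq> V"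
    using \<open>x \<noteq> y\<close> \<open>p \<noteq> y\<close> \<open>q \<noteq> x\<close> \<open>p \<noteq> q\<close> \<open>a \<noteq> b\<close> p q aV bV xyV by auto
  ultimately show ?thesis by blast
qed

theorem theorem4p8:
  fixes n \<Delta> \<Delta>' :: nat
    and V :: "'a set" and E :: "'a set set"
    and V' :: "'b set" and E' :: "'b set set"
  assumes "n \<ge> 6"
    and "strong_central_two_tree 2 \<Delta> V E"
    and "card V = n"
    and "has_tail_set V E {2, 3}"
    and "card {v \<in> tail V E. degree E v = 3} = 2"
    and "strong_central_two_tree 2 \<Delta>' V' E'"
    and "card V' = n"
    and "has_tail_set V' E' {2, 3}"
    and "card {v \<in> tail V' E'. degree E' v = 3} = 2"
  shows "graph_isomorphic V E V' E'"
proof -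
  have tt: "two_tree V E" "two_tree V' E'"
    using assms(2,6) by (auto simp: strong_central_two_tree_def central_two_tree_def)
  obtain x y p q a b where 1: "distinct [x, y, p, q, a, b]" "{x, y, p, q, a, b} \<subseteq> V"
      "E = book_with_ears V x y p q a b"
    using strong_bicentral_is_book_with_ears[of V \<Delta> E] assms by auto
  obtain x' y' p' q' a' b' where 2: "distinct [x', y', p', q', a', b']"
      "{x', y', p', q', a', b'} \<subseteq> V'" "E' = book_with_ears V' x' y' p' q' a' b'"
    using strong_bicentral_is_book_with_ears[of V' \<Delta>' E'] assms by auto
  obtain f where f: "bij_betw f V V'"
    "map f [x, y, p, q, a, b] = [x', y', p', q', a', b']"
    using ex_bij_betw_extending_list[of V V' "[x, y, p, q, a, b]" "[x', y', p', q', a', b']"]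
      1 2 assms(3,7) two_tree_wf(1)[OF tt(1)] two_tree_wf(1)[OF tt(2)] by auto
  \<comment> \<open>Since \<open>f\<close> matches the vertex sets and all six distinguished
    vertices, it carries one canonical form to the other.\<close>
  have "(`) f ` E = E'"
    unfolding 1(3) 2(3)
    using book_with_ears_image[of f V x y p q a b] f 1(2) by (simp add: bij_betw_def)
  then show ?thesis
    using graph_isomorphic_image[OF f(1)] two_tree_wf(2)[OF tt(1)] by metis
qed

end
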